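(* Let $\mathcal{A}$ be an Adinkra with $N$ colors and vertex set $V$ that is a prism, i.e. $\mathcal{A}=\mathcal{A}'\times I$ for some Adinkra $\mathcal{A}'$ with $N-1$ colors. Then the invariant factors of the boson–fermion matrix $X$ of $\mathcal{A}$ are $$(1^{\#V/4},\,N^{\#V/4}),$$ and the invariant factors of the signed Laplacian $L$ of $\mathcal{A}$ are $$(1^{\#V/2},\,(N(N-1))^{\#V/2}),$$ where exponents denote multiplicities.
   Context: A signed graph is a finite undirected simple graph $(V,E)$ with a signature $\mu:E\to\{-1,1\}$; edges with $\mu(e)=-1$ are called dashed, those with $\mu(e)=1$ solid. An Adinkra with $N\ge 1$ colors is a non-empty finite bipartite signed graph $(V,E,\mu)$ (with a fixed bipartition of $V$ into bosons and fermions, every edge joining a boson to a fermion), together with an assignment of one of $N$ colors to each edge and a function $h:V\to\mathbb{Z}$ (the function $h$ plays no role here), such that: (i) each vertex is incident to exactly $N$ edges, one of each color; (ii) for any two distinct colors, the subgraph consisting of all edges of those two colors is a disjoint union of $4$-cycles (called bicolor cycles); (iii) every bicolor cycle contains an odd number of dashed edges; (iv) $|h(v)-h(w)|=1$ for adjacent $v,w$. An Adinkra need not be connected; there are $\#V/2$ bosons and $\#V/2$ fermions. Prism: given an Adinkra $\mathcal{A}'$ with $n$ colors and vertex set $V'$, the prism $\mathcal{A}'\times I$ is the Adinkra with $n+1$ colors and vertex set $V'\times\{0,1\}$ whose edges are: for each edge $e$ of $\mathcal{A}'$ of color $j$ joining $v$ and $w$, and each $t\in\{0,1\}$, an edge of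 color $j$ joining $(v,t)$ and $(w,t)$, dashed if and only if $e$ is; and for each $v\in V'$ an edge of color $n+1$ joining $(v,0)$ and $(v,1)$, solid if $v$ is a fermion and dashed if $v$ is a boson. (The vertex $(v,0)$ has the same type as $v$, and $(v,1)$ the opposite type.) $X$ is the $\frac{\#V}{2}\times\frac{\#V}{2}$ integer matrix whose $(i,j)$ entry is $\mu(e)$ if there is an edge $e$ between the $i$th boson and $j$th fermion, and $0$ otherwise. With bosons ordered first, the signed Laplacian is $L=\begin{pmatrix}NI&-X\\-X^T&NI\end{pmatrix}$. The invariant factors of an integer square matrix are the nonnegative diagonal entries $d_1\mid d_2\mid\cdots$ of its Smith Normal Form over $\mathbb{Z}$, listed with multiplicity. *)

theory Defs
  imports "Jordan_Normal_Form.Matrix"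
begin

section \<open>Adinkras\<close>

text \<open>An edge is the set of its two endpoints. The fields \<open>mu\<close>, \<open>color\<close> and \<open>height\<close>
  are total functions; only their values on edges, respectively on vertices, are ever used.\<close>

record 'v adinkra_graph =
  verts :: "'v set"
  bosons :: "'v set"
  edges :: "'v set set"
  mu :: "'v set \<Rightarrow> int"
  color :: "'v set \<Rightarrow> nat"
  height :: "'v \<Rightarrow> int"

definition fermions :: "'v adinkra_graph \<Rightarrow> 'v set" where
  "fermions A = verts A - bosons A"

definition dashed :: "'v adinkra_graph \<Rightarrow> 'v set \<Rightarrow> bool" where
  "dashed A e \<longleftrightarrow> mu A e = - 1"

definition color_edges :: "'v adinkra_graph \<Rightarrow> nat \<Rightarrow> 'v set set" where
  "color_edges A i = {e \<in> edges A. color A e = i}"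

definition four_cycle :: "'v set set \<Rightarrow> bool" where
  "four_cycle F \<longleftrightarrow>
     (\<exists>a b c d. distinct [a, b, c, d] \<and> F = {{a, b}, {b, c}, {c, d}, {d, a}})"

definition disjoint_union_of_four_cycles :: "'v set set \<Rightarrow> bool" where
  "disjoint_union_of_four_cycles E \<longleftrightarrow>
     (\<exists>\<C>. (\<forall>F\<in>\<C>. four_cycle F) \<and>
          (\<forall>F\<in>\<C>. \<forall>G\<in>\<C>. F \<noteq> G \<longrightarrow> \<Union>F \<inter> \<Union>G = {}) \<and>
          \<Union>\<C> = E)"

text \<open>When the edges of colors \<open>i\<close> and \<open>j\<close> form a disjoint union of 4-cycles, these cycles
  are exactly the 4-cycles contained in that subgraph.\<close>

definition bicolor_cycle :: "'v adinkra_graph \<Rightarrow> nat \<Rightarrow> nat \<Rightarrow> 'v set set \<Rightarrow> bool" where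
  "bicolor_cycle A i j F \<longleftrightarrow> four_cycle F \<and> F \<subseteq> color_edges A i \<union> color_edges A j"

definition adinkra :: "nat \<Rightarrow> 'v adinkra_graph \<Rightarrow> bool" where
  "adinkra N A \<longleftrightarrow>
     N \<ge> 1 \<and>
     finite (verts A) \<and> verts A \<noteq> {} \<and>
     bosons A \<subseteq> verts A \<and>
     (\<forall>e\<in>edges A. \<exists>b\<in>bosons A. \<exists>f\<in>fermions A. e = {b, f}) \<and>
     (\<forall>e\<in>edges A. mu A e \<in> {- 1, 1}) \<and>
     (\<forall>e\<in>edges A. color A e \<in> {1..N}) \<and>
     (\<forall>v\<in>verts A. card {e \<in> edges A. v \<in> e} = N \<and>
        (\<forall>i\<in>{1..N}. \<exists>!e. e \<in> edges A \<and> v \<in> e \<and> color A e = i)) \<and>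
     (\<forall>i\<in>{1..N}. \<forall>j\<in>{1..N}. i \<noteq> j \<longrightarrow>
        disjoint_union_of_four_cycles (color_edges A i \<union> color_edges A j)) \<and>
     (\<forall>i\<in>{1..N}. \<forall>j\<in>{1..N}. i \<noteq> j \<longrightarrow>
        (\<forall>F. bicolor_cycle A i j F \<longrightarrow> odd (card {e \<in> F. dashed A e}))) \<and>
     (\<forall>v w. {v, w} \<in> edges A \<longrightarrow> \<bar>height A v - height A w\<bar> = 1)"

text \<open>\<open>is_prism n A' A\<close>: \<open>A\<close> is the prism over the \<open>n\<close>-color Adinkra \<open>A'\<close>. Signs and colors
  are compared on edges only, and the height function of the prism is left arbitrary.\<close>

definition is_prism :: "nat \<Rightarrow> 'v adinkra_graph \<Rightarrow> ('v \<times> nat) adinkra_graph \<Rightarrow> bool" where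
  "is_prism n A' A \<longleftrightarrow>
     verts A = verts A' \<times> {0, 1} \<and>
     bosons A = bosons A' \<times> {0} \<union> fermions A' \<times> {1} \<and>
     edges A = {(\<lambda>v. (v, t)) ` e |e t. e \<in> edges A' \<and> t \<in> {0, 1}}
             \<union> {{(v, 0), (v, 1)} |v. v \<in> verts A'} \<and>
     (\<forall>e\<in>edges A'. \<forall>t\<in>{0, 1}.
        color A ((\<lambda>v. (v, t)) ` e) = color A' e \<and> mu A ((\<lambda>v. (v, t)) ` e) = mu A' e) \<and>
     (\<forall>v\<in>verts A'.
        color A {(v, 0), (v, 1)} = n + 1 \<and>
        mu A {(v, 0), (v, 1)} = (if v \<in> bosons A' then - 1 else 1))"


section \<open>The boson-fermion matrix and the signed Laplacian\<close>

definition enumerates :: "'v list \<Rightarrow> 'v set \<Rightarrow> bool" where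
  "enumerates vs S \<longleftrightarrow> distinct vs \<and> set vs = S"

definition boson_fermion_mat :: "'v adinkra_graph \<Rightarrow> 'v list \<Rightarrow> 'v list \<Rightarrow> int mat" where
  "boson_fermion_mat A bs fs =
     mat (length bs) (length fs)
       (\<lambda>(i, j). if {bs ! i, fs ! j} \<in> edges A then mu A {bs ! i, fs ! j} else 0)"

definition signed_laplacian :: "nat \<Rightarrow> 'v adinkra_graph \<Rightarrow> 'v list \<Rightarrow> 'v list \<Rightarrow> int mat" where
  "signed_laplacian N A bs fs =
     (let X = boson_fermion_mat A bs fs in
      four_block_mat (int N \<cdot>\<^sub>m 1\<^sub>m (length bs)) (- X)
                     (- transpose_mat X) (int N \<cdot>\<^sub>m 1\<^sub>m (length fs)))"


section \<open>Invariant factors\<close>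

definition smith_normal_form_of :: "int mat \<Rightarrow> int mat \<Rightarrow> bool" where
  "smith_normal_form_of M S \<longleftrightarrow>
     square_mat M \<and>
     (\<exists>P Q. P \<in> carrier_mat (dim_row M) (dim_row M) \<and> invertible_mat P \<and>
            Q \<in> carrier_mat (dim_row M) (dim_row M) \<and> invertible_mat Q \<and>
            S = P * M * Q) \<and>
     diagonal_mat S \<and>
     (\<forall>i<dim_row S. S $$ (i, i) \<ge> 0) \<and>
     (\<forall>i. Suc i < dim_row S \<longrightarrow> S $$ (i, i) dvd S $$ (Suc i, Suc i))"

text \<open>A relation rather than a function, so that stating it does not presuppose existence and
  uniqueness of the Smith Normal Form. Multiplicities are recorded by repetition in the list.\<close>

definition has_invariant_factors :: "int mat \<Rightarrow> int list \<Rightarrow> bool" where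
  "has_invariant_factors M ds \<longleftrightarrow> (\<exists>S. smith_normal_form_of M S \<and> diag_mat S = ds)"

end

theory Submission
  imports Defs
begin

text \<open>
  Let \<open>S\<close> be the signed adjacency matrix of the base Adinkra \<open>A'\<close>, which has \<open>n = N - 1\<close> colors.
  Write \<open>S\<close> as the sum over the colors of signed permutation matrices \<open>S\<^sub>i\<close>. Each \<open>S\<^sub>i\<close> squares to
  the identity, and the odd number of dashed edges on every bicolor cycle says that \<open>S\<^sub>i\<close> and
  \<open>S\<^sub>j\<close> anticommute for \<open>i \<noteq> j\<close>. These Clifford relations give \<open>S\<^sup>2 = n\<close>
  (\<open>signed_adj_square\<close>).

  The vertical edges of the prism provide a unimodular block on which to pivot. Order the rows of
  the boson-fermion matrix as (fermions at level 1, bosons at level 0) and its columns as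
  (fermions at level 0, bosons at level 1); with \<open>X\<close> the boson-fermion matrix of \<open>A'\<close>, it becomes
  the block matrix with rows \<open>(1, X\<^sup>T)\<close> and \<open>(X, - 1)\<close>. The Schur complement of the block \<open>1\<close> is
  \<open>- 1 - X X\<^sup>T = - (n + 1) = - N\<close>, so the invariant factors are \<open>1\<close> and \<open>N\<close>, in equal numbers.

  Let \<open>\<epsilon>\<close> be the diagonal matrix with entry \<open>1\<close> at bosons and \<open>- 1\<close> at fermions of \<open>A'\<close>. With rows
  ordered (level 1, level 0) and columns (level 0, level 1), the Laplacian becomes the block matrix
  with rows \<open>(\<epsilon>, T)\<close> and \<open>(T, \<epsilon>)\<close>, where \<open>T = N - S\<close>. As \<open>S\<close> joins bosons to fermions only, it
  anticommutes with \<open>\<epsilon>\<close>, and the Schur complement of the corner \<open>\<epsilon>\<close> is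
  \<open>\<epsilon> - T \<epsilon> T = \<epsilon> - \<epsilon> (N + S) (N - S) = \<epsilon> (1 - N\<^sup>2 + n) = - N (N - 1) \<epsilon>\<close>.
  Since \<open>\<epsilon>\<close> is unimodular, the invariant factors are \<open>1\<close> and \<open>N (N - 1)\<close>, in equal numbers.

  In both cases the conclusion is drawn by \<open>has_invariant_factors_Schur\<close>.
\<close>

section \<open>Integer matrices indexed by lists\<close>

text \<open>The bosons, the fermions and the two levels of a prism come in no common order. Keeping the rows
  and columns labelled by lists of vertices turns a change of order into a change of lists, and
  identities between matrices into identities between sums over vertices.\<close>

definition fun_mat :: "('a \<Rightarrow> 'b \<Rightarrow> int) \<Rightarrow> 'a list \<Rightarrow> 'b list \<Rightarrow> int mat" where
  "fun_mat f xs ys = mat (length xs) (length ys) (\<lambda>(i, j). f (xs ! i) (ys ! j))"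

lemma dim_fun_mat [simp]:
  "dim_row (fun_mat f xs ys) = length xs" "dim_col (fun_mat f xs ys) = length ys"
  by (simp_all add: fun_mat_def)

lemma index_fun_mat [simp]:
  "i < length xs \<Longrightarrow> j < length ys \<Longrightarrow> fun_mat f xs ys $$ (i, j) = f (xs ! i) (ys ! j)"
  by (simp add: fun_mat_def)

lemma fun_mat_cong:
  assumes "\<And>x y. x \<in> set xs \<Longrightarrow> y \<in> set ys \<Longrightarrow> f x y = g x y"
  shows "fun_mat f xs ys = fun_mat g xs ys"
  using assms by (auto simp: fun_mat_def intro!: eq_matI)

lemma fun_mat_map: "fun_mat f (map p xs) (map q ys) = fun_mat (\<lambda>x y. f (p x) (q y)) xs ys"
  by (auto simp: fun_mat_def intro!: eq_matI)

lemma fun_mat_append: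
  "fun_mat f (xs @ xs') (ys @ ys') =
     four_block_mat (fun_mat f xs ys) (fun_mat f xs ys') (fun_mat f xs' ys) (fun_mat f xs' ys')"
  by (auto simp: fun_mat_def nth_append intro!: eq_matI)

lemma fun_mat_mult:
  assumes "distinct ys"
  shows "fun_mat f xs ys * fun_mat g ys zs = fun_mat (\<lambda>x z. \<Sum>y\<in>set ys. f x y * g y z) xs zs"
proof (rule eq_matI)
  fix i j assume "i < dim_row (fun_mat (\<lambda>x z. \<Sum>y\<in>set ys. f x y * g y z) xs zs)"
    "j < dim_col (fun_mat (\<lambda>x z. \<Sum>y\<in>set ys. f x y * g y z) xs zs)"
  then have ij: "i < length xs" "j < length zs" by simp_all
  have "(\<Sum>y\<in>set ys. f (xs ! i) y * g y (zs ! j))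
      = (\<Sum>k = 0..<length ys. f (xs ! i) (ys ! k) * g (ys ! k) (zs ! j))"
    by (rule sum.reindex_bij_betw[symmetric])
       (use bij_betw_nth[OF assms, of "{0..<length ys}" "set ys"] in \<open>simp add: lessThan_atLeast0\<close>)
  then show "(fun_mat f xs ys * fun_mat g ys zs) $$ (i, j)
      = fun_mat (\<lambda>x z. \<Sum>y\<in>set ys. f x y * g y z) xs zs $$ (i, j)"
    using ij by (simp add: scalar_prod_def)
qed simp_all

lemma fun_mat_one:
  assumes "distinct xs"
  shows "fun_mat (\<lambda>x y. if x = y then 1 else 0) xs xs = 1\<^sub>m (length xs)"
  using assms by (auto simp: fun_mat_def nth_eq_iff_index_eq intro!: eq_matI)

lemma fun_mat_add: "fun_mat f xs ys + fun_mat g xs ys = fun_mat (\<lambda>x y. f x y + g x y) xs ys"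
  by (auto simp: fun_mat_def intro!: eq_matI)

lemma fun_mat_smult: "c \<cdot>\<^sub>m fun_mat f xs ys = fun_mat (\<lambda>x y. c * f x y) xs ys"
  by (auto simp: fun_mat_def intro!: eq_matI)

lemma diag_fun_mat_square:
  assumes "distinct xs" "\<And>x. x \<in> set xs \<Longrightarrow> d x * d x = 1"
  shows "fun_mat (\<lambda>x y. if x = y then d x else 0) xs xs * fun_mat (\<lambda>x y. if x = y then d x else 0) xs xs
    = 1\<^sub>m (length xs)"
proof -
  have "fun_mat (\<lambda>x y. if x = y then d x else 0) xs xs * fun_mat (\<lambda>x y. if x = y then d x else 0) xs xs
      = fun_mat (\<lambda>x y. if x = y then 1 else 0) xs xs"
    unfolding fun_mat_mult[OF assms(1)]
    by (rule fun_mat_cong) (simp add: assms(2) if_distrib[of "\<lambda>t. t * _"] cong: if_cong)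
  then show ?thesis by (simp add: fun_mat_one assms(1))
qed

section \<open>Invariant factors under unimodular transformations\<close>

lemma invertible_matI:
  assumes "P \<in> carrier_mat n n" "P' \<in> carrier_mat n n" "P * P' = 1\<^sub>m n" "P' * P = 1\<^sub>m n"
  shows "invertible_mat P"
  using assms unfolding invertible_mat_def inverts_mat_def by auto

lemma invertible_mat_mult:
  fixes P Q :: "int mat"
  assumes "P \<in> carrier_mat n n" "Q \<in> carrier_mat n n" "invertible_mat P" "invertible_mat Q"
  shows "invertible_mat (P * Q)"
proof -
  obtain P' where P': "P * P' = 1\<^sub>m n" "P' * P = 1\<^sub>m (dim_row P')"
    using assms unfolding invertible_mat_def inverts_mat_def by auto
  obtain Q' where Q': "Q * Q' = 1\<^sub>m n" "Q' * Q = 1\<^sub>m (dim_row Q')"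
    using assms unfolding invertible_mat_def inverts_mat_def by auto
  have c: "P' \<in> carrier_mat n n" "Q' \<in> carrier_mat n n"
    using P' Q' assms(1,2) by (metis carrier_mat_triv carrier_matD(2) index_mult_mat(3) index_one_mat(3))+
  have "(P * Q) * (Q' * P') = P * (Q * Q') * P'"
    using assms(1,2) c by (simp add: assoc_mult_mat[of _ n n _ n _ n])
  then have 1: "(P * Q) * (Q' * P') = 1\<^sub>m n"
    using assms(1,2) c P' Q' by simp
  have "(Q' * P') * (P * Q) = Q' * (P' * P) * Q"
    using assms(1,2) c by (simp add: assoc_mult_mat[of _ n n _ n _ n])
  then have 2: "(Q' * P') * (P * Q) = 1\<^sub>m n"
    using assms(1,2) c P' Q' by simp
  show ?thesis
    by (rule invertible_matI[OF _ _ 1 2]) (use assms(1,2) c in auto)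
qed

text \<open>Unimodular matrices form a group, so those that diagonalize \<open>P * M * Q\<close> absorb \<open>P\<close> and \<open>Q\<close>.\<close>

lemma has_invariant_factors_unimodular:
  assumes M: "M \<in> carrier_mat n n"
    and P: "P \<in> carrier_mat n n" "invertible_mat P"
    and Q: "Q \<in> carrier_mat n n" "invertible_mat Q"
    and "has_invariant_factors (P * M * Q) ds"
  shows "has_invariant_factors M ds"
proof -
  obtain S P' Q' where S: "diag_mat S = ds" "S = P' * (P * M * Q) * Q'" "diagonal_mat S"
      "\<forall>i<dim_row S. S $$ (i, i) \<ge> 0"
      "\<forall>i. Suc i < dim_row S \<longrightarrow> S $$ (i, i) dvd S $$ (Suc i, Suc i)"
    and P': "P' \<in> carrier_mat n n" "invertible_mat P'"
    and Q': "Q' \<in> carrier_mat n n" "invertible_mat Q'"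
    using assms(6) P(1) unfolding has_invariant_factors_def smith_normal_form_of_def by auto
  have "S = (P' * P) * M * (Q * Q')"
    using S(2) M P(1) Q(1) P'(1) Q'(1) by (simp add: assoc_mult_mat[of _ n n _ n _ n])
  moreover have "invertible_mat (P' * P)" "invertible_mat (Q * Q')"
    using invertible_mat_mult P P' Q Q' by blast+
  moreover have "P' * P \<in> carrier_mat n n" "Q * Q' \<in> carrier_mat n n"
    using P P' Q Q' by auto
  moreover have "dim_row M = n" "square_mat M" using M by auto
  ultimately have "smith_normal_form_of M S"
    unfolding smith_normal_form_of_def using S(3-5) by metis
  then show ?thesis
    unfolding has_invariant_factors_def using S(1) by blast
qed

lemma reindexing_mat_invertible:
  assumes "distinct xs" "distinct xs'" "set xs = set xs'"
  shows "invertible_mat (fun_mat (\<lambda>x y. if x = y then 1 else 0) xs xs')"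
proof -
  have "length xs = length xs'" using assms by (metis distinct_card)
  moreover have inv: "fun_mat (\<lambda>x y. if x = y then 1 else 0) us vs * fun_mat (\<lambda>x y. if x = y then 1 else 0) vs us
      = 1\<^sub>m (length us)" if "distinct us" "distinct vs" "set us = set vs" for us vs :: "'a list"
  proof -
    have "fun_mat (\<lambda>x y. if x = y then 1 else 0) us vs * fun_mat (\<lambda>x y. if x = y then 1 else 0) vs us
       = fun_mat (\<lambda>x y. if x = y then 1 else 0) us us"
      unfolding fun_mat_mult[OF that(2)]
      by (rule fun_mat_cong) (simp add: that if_distrib[of "\<lambda>t. t * _"] cong: if_cong)
    then show ?thesis by (simp add: fun_mat_one that)
  qed
  ultimately show ?thesis
    using assms
    by (intro invertible_matI[of _ "length xs" "fun_mat (\<lambda>x y. if x = y then 1 else 0) xs' xs"])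
       (auto simp: inv carrier_matI)
qed

text \<open>The matrix of the function \<open>x = y\<close>, with rows in one order and columns in the other, is a
  permutation matrix; multiplying by it reorders the rows or the columns.\<close>

lemma has_invariant_factors_reindex:
  assumes "distinct xs" "distinct xs'" "set xs = set xs'"
    and "distinct ys" "distinct ys'" "set ys = set ys'"
    and "length xs = length ys"
    and "has_invariant_factors (fun_mat f xs' ys') ds"
  shows "has_invariant_factors (fun_mat f xs ys) ds"
proof -
  have len: "length xs' = length xs" "length ys' = length xs"
    using assms by (metis distinct_card)+
  let ?P = "fun_mat (\<lambda>x y. if x = y then 1 else 0) xs' xs"
  let ?Q = "fun_mat (\<lambda>x y. if x = y then 1 else 0) ys ys'"
  have "?P * fun_mat f xs ys = fun_mat f xs' ys"
    unfolding fun_mat_mult[OF assms(1)]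
    by (rule fun_mat_cong) (simp add: assms if_distrib[of "\<lambda>t. t * _"] cong: if_cong)
  moreover have "fun_mat f xs' ys * ?Q = fun_mat f xs' ys'"
    unfolding fun_mat_mult[OF assms(4)]
    by (rule fun_mat_cong) (simp add: assms if_distrib[of "\<lambda>t. _ * t"] cong: if_cong)
  ultimately have "has_invariant_factors (?P * fun_mat f xs ys * ?Q) ds"
    using assms(8) by simp
  moreover have "fun_mat f xs ys \<in> carrier_mat (length xs) (length xs)"
      "?P \<in> carrier_mat (length xs) (length xs)" "?Q \<in> carrier_mat (length xs) (length xs)"
    using len assms(7) by (auto intro!: carrier_matI)
  moreover have "invertible_mat ?P" "invertible_mat ?Q"
    using assms by (auto intro!: reindexing_mat_invertible)
  ultimately show ?thesis
    using has_invariant_factors_unimodular by blast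
qed

lemma has_invariant_factors_diag:
  assumes "c \<ge> 0"
  shows "has_invariant_factors
    (four_block_mat (1\<^sub>m k) (0\<^sub>m k k) (0\<^sub>m k k) (c \<cdot>\<^sub>m 1\<^sub>m k)) (replicate k 1 @ replicate k c)"
proof -
  let ?S = "four_block_mat (1\<^sub>m k) (0\<^sub>m k k) (0\<^sub>m k k) (c \<cdot>\<^sub>m 1\<^sub>m k) :: int mat"
  have car: "?S \<in> carrier_mat (k + k) (k + k)" by simp
  have "invertible_mat (1\<^sub>m (k + k) :: int mat)"
    by (rule invertible_matI[of _ "k + k" "1\<^sub>m (k + k)"]) auto
  moreover have "?S = 1\<^sub>m (k + k) * ?S * 1\<^sub>m (k + k)"
    by (metis car left_mult_one_mat right_mult_one_mat)
  moreover have "1\<^sub>m (k + k) \<in> carrier_mat (dim_row ?S) (dim_row ?S)" by simp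
  ultimately have "smith_normal_form_of ?S ?S"
    unfolding smith_normal_form_of_def using assms
    by (intro conjI exI[of _ "1\<^sub>m (k + k)"]) (auto simp: diagonal_mat_def)
  moreover have "diag_mat ?S = replicate k 1 @ replicate k c"
    by (rule nth_equalityI) (auto simp: diag_mat_def nth_append)
  ultimately show ?thesis
    unfolding has_invariant_factors_def by blast
qed

text \<open>Eliminating \<open>C\<close> and \<open>B\<close> against the unimodular pivot \<open>A\<close> leaves the Schur complement
  \<open>D - C * A' * B\<close>. When this is a multiple \<open>c\<close> of a unimodular matrix \<open>J\<close>, multiplying by the
  inverse \<open>J'\<close> makes it scalar. The row operations and the division by the blocks \<open>A\<close> and \<open>J\<close> are
  collected in one block triangular matrix \<open>?P\<close>, whose inverse is \<open>?P'\<close>.\<close>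

lemma has_invariant_factors_Schur:
  fixes A A' B C D J J' :: "int mat"
  assumes car: "A \<in> carrier_mat k k" "A' \<in> carrier_mat k k" "B \<in> carrier_mat k k"
      "C \<in> carrier_mat k k" "J \<in> carrier_mat k k" "J' \<in> carrier_mat k k"
    and A: "A * A' = 1\<^sub>m k" "A' * A = 1\<^sub>m k"
    and J: "J * J' = 1\<^sub>m k" "J' * J = 1\<^sub>m k"
    and D: "D = C * A' * B + c \<cdot>\<^sub>m J" and c: "c \<ge> 0"
  shows "has_invariant_factors (four_block_mat A B C D) (replicate k 1 @ replicate k c)"
proof -
  \<comment> \<open>The multiple of the first block row to subtract from \<open>J'\<close> times the second one.\<close>
  define F where "F = J' * C * A'"
  have F: "F \<in> carrier_mat k k" using car by (auto simp: F_def)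
  have Dc: "D \<in> carrier_mat k k" using car D by auto
  have FA: "F * A = J' * C"
    using car A unfolding F_def by (simp add: assoc_mult_mat[of _ k k _ k _ k])
  have JC: "J * F = C * A'"
  proof -
    have "J * F = (J * J') * C * A'"
      using car unfolding F_def by (simp add: assoc_mult_mat[of _ k k _ k _ k])
    then show ?thesis using car J by simp
  qed
  have JD: "J' * D = F * B + c \<cdot>\<^sub>m 1\<^sub>m k"
    using car J unfolding D F_def
    by (simp add: mult_add_distrib_mat[of _ k k _ k] mult_smult_distrib[of _ k k _ k]
        assoc_mult_mat[of _ k k _ k _ k])
  have FA0: "- (F * A) + J' * C = 0\<^sub>m k k"
    using car F FA by (auto intro!: eq_matI)
  have JF0: "C * A' + - (J * F) = 0\<^sub>m k k"
    using car F JC by (auto intro!: eq_matI)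
  have FB: "- (F * B) + J' * D = c \<cdot>\<^sub>m 1\<^sub>m k"
    unfolding JD using car F by (auto intro!: eq_matI)
  define G where "G = A' * B"
  have G: "G \<in> carrier_mat k k" using car by (simp add: G_def)
  have G0: "- G + G = 0\<^sub>m k k" "G + - G = 0\<^sub>m k k"
    using G by (auto intro!: eq_matI)
  have uminus_zero: "- 0\<^sub>m k k = (0\<^sub>m k k :: int mat)"
    by (auto intro!: eq_matI)
  let ?P = "four_block_mat A' (0\<^sub>m k k) (- F) J'"
  let ?P' = "four_block_mat A (0\<^sub>m k k) C J"
  let ?Q = "four_block_mat (1\<^sub>m k) (- G) (0\<^sub>m k k) (1\<^sub>m k)"
  let ?Q' = "four_block_mat (1\<^sub>m k) G (0\<^sub>m k k) (1\<^sub>m k)"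
  have mult: "four_block_mat A1 B1 C1 D1 * four_block_mat A2 B2 C2 D2 =
      four_block_mat (A1 * A2 + B1 * C2) (A1 * B2 + B1 * D2) (C1 * A2 + D1 * C2) (C1 * B2 + D1 * D2)"
    if "A1 \<in> carrier_mat k k" "B1 \<in> carrier_mat k k" "C1 \<in> carrier_mat k k" "D1 \<in> carrier_mat k k"
      "A2 \<in> carrier_mat k k" "B2 \<in> carrier_mat k k" "C2 \<in> carrier_mat k k" "D2 \<in> carrier_mat k k"
    for A1 B1 C1 D1 A2 B2 C2 D2 :: "int mat"
    using that by (rule mult_four_block_mat)
  have one: "1\<^sub>m (k + k) = (four_block_mat (1\<^sub>m k) (0\<^sub>m k k) (0\<^sub>m k k) (1\<^sub>m k) :: int mat)"
    by (auto intro!: eq_matI)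
  have "?P * four_block_mat A B C D = four_block_mat (1\<^sub>m k) G (0\<^sub>m k k) (c \<cdot>\<^sub>m 1\<^sub>m k)"
    using car F Dc by (simp add: mult A FA0 FB G_def uminus_zero)
  moreover have "four_block_mat (1\<^sub>m k) G (0\<^sub>m k k) (c \<cdot>\<^sub>m 1\<^sub>m k) * ?Q
      = four_block_mat (1\<^sub>m k) (0\<^sub>m k k) (0\<^sub>m k k) (c \<cdot>\<^sub>m 1\<^sub>m k)"
    using G by (simp add: mult G0 uminus_zero)
  ultimately have "?P * four_block_mat A B C D * ?Q
      = four_block_mat (1\<^sub>m k) (0\<^sub>m k k) (0\<^sub>m k k) (c \<cdot>\<^sub>m 1\<^sub>m k)"
    by simp
  moreover have "invertible_mat ?P"
  proof (rule invertible_matI[of _ "k + k" ?P'])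
    show "?P * ?P' = 1\<^sub>m (k + k)"
      unfolding one using car F by (simp add: mult A J FA0 uminus_zero)
    show "?P' * ?P = 1\<^sub>m (k + k)"
      unfolding one using car F by (simp add: mult A J JF0 uminus_zero)
  qed (use car F in auto)
  moreover have "invertible_mat ?Q"
  proof (rule invertible_matI[of _ "k + k" ?Q'])
    show "?Q * ?Q' = 1\<^sub>m (k + k)" "?Q' * ?Q = 1\<^sub>m (k + k)"
      unfolding one using G by (simp_all add: mult G0 uminus_zero)
  qed (use G in auto)
  ultimately show ?thesis
    using has_invariant_factors_diag[OF c, of k] car Dc F
      has_invariant_factors_unimodular[of "four_block_mat A B C D" "k + k" ?P ?Q]
    by simp
qed

section \<open>The signed adjacency matrix of an Adinkra\<close>

definition signed_adj :: "'v adinkra_graph \<Rightarrow> 'v \<Rightarrow> 'v \<Rightarrow> int" where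
  "signed_adj A v w = (if {v, w} \<in> edges A then mu A {v, w} else 0)"

text \<open>The involution of the vertices along the edges of color \<open>i\<close>; its signed permutation matrix is the
  summand of color \<open>i\<close> of the signed adjacency matrix.\<close>

definition color_nbr :: "'v adinkra_graph \<Rightarrow> nat \<Rightarrow> 'v \<Rightarrow> 'v" where
  "color_nbr A i v = (THE w. {v, w} \<in> edges A \<and> color A {v, w} = i)"

lemma signed_adj_sym: "signed_adj A v w = signed_adj A w v"
  by (simp add: signed_adj_def insert_commute)

lemma adinkraD:
  assumes "adinkra n A"
  shows "n \<ge> 1" "finite (verts A)" "bosons A \<subseteq> verts A"
    and "e \<in> edges A \<Longrightarrow> \<exists>b\<in>bosons A. \<exists>f\<in>fermions A. e = {b, f}"
    and "e \<in> edges A \<Longrightarrow> mu A e \<in> {- 1, 1}"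
    and "e \<in> edges A \<Longrightarrow> color A e \<in> {1..n}"
    and "v \<in> verts A \<Longrightarrow> i \<in> {1..n} \<Longrightarrow> \<exists>!e. e \<in> edges A \<and> v \<in> e \<and> color A e = i"
    and "i \<in> {1..n} \<Longrightarrow> j \<in> {1..n} \<Longrightarrow> i \<noteq> j \<Longrightarrow>
      disjoint_union_of_four_cycles (color_edges A i \<union> color_edges A j)"
    and "i \<in> {1..n} \<Longrightarrow> j \<in> {1..n} \<Longrightarrow> i \<noteq> j \<Longrightarrow> bicolor_cycle A i j F \<Longrightarrow>
      odd (card {e \<in> F. dashed A e})"
proof -
  note c4 = assms[unfolded adinkra_def, THEN conjunct2, THEN conjunct2, THEN conjunct2]
  note c7 = c4[THEN conjunct2, THEN conjunct2, THEN conjunct2]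
  note c9 = c7[THEN conjunct2, THEN conjunct2]
  show "n \<ge> 1" "finite (verts A)"
    by (rule assms[unfolded adinkra_def, THEN conjunct1]
        assms[unfolded adinkra_def, THEN conjunct2, THEN conjunct1])+
  show "bosons A \<subseteq> verts A"
    by (rule c4[THEN conjunct1])
  show "e \<in> edges A \<Longrightarrow> \<exists>b\<in>bosons A. \<exists>f\<in>fermions A. e = {b, f}"
    by (rule c4[THEN conjunct2, THEN conjunct1, THEN bspec])
  show "e \<in> edges A \<Longrightarrow> mu A e \<in> {- 1, 1}"
    by (rule c4[THEN conjunct2, THEN conjunct2, THEN conjunct1, THEN bspec])
  show "e \<in> edges A \<Longrightarrow> color A e \<in> {1..n}"
    by (rule c7[THEN conjunct1, THEN bspec])
  show "v \<in> verts A \<Longrightarrow> i \<in> {1..n} \<Longrightarrow> \<exists>!e. e \<in> edges A \<and> v \<in> e \<and> color A e = i"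
    by (rule c7[THEN conjunct2, THEN conjunct1, THEN bspec, THEN conjunct2, THEN bspec])
  show "i \<in> {1..n} \<Longrightarrow> j \<in> {1..n} \<Longrightarrow> i \<noteq> j \<Longrightarrow>
      disjoint_union_of_four_cycles (color_edges A i \<union> color_edges A j)"
    by (rule c9[THEN conjunct1, THEN bspec, THEN bspec, THEN mp])
  show "i \<in> {1..n} \<Longrightarrow> j \<in> {1..n} \<Longrightarrow> i \<noteq> j \<Longrightarrow> bicolor_cycle A i j F \<Longrightarrow>
      odd (card {e \<in> F. dashed A e})"
    by (rule c9[THEN conjunct2, THEN conjunct1, THEN bspec, THEN bspec, THEN mp, THEN spec, THEN mp])
qed

lemma adinkra_edgeD:
  assumes "adinkra n A" "{v, w} \<in> edges A"
  shows "v \<in> verts A" "w \<in> verts A" "v \<noteq> w" "v \<in> bosons A \<longleftrightarrow> w \<notin> bosons A"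
    and "mu A {v, w} \<in> {- 1, 1}" "color A {v, w} \<in> {1..n}"
proof -
  obtain b f where "b \<in> bosons A" "f \<in> fermions A" and e: "{v, w} = {b, f}"
    using adinkraD(4)[OF assms] by (elim bexE)
  moreover have "b \<in> verts A" using adinkraD(3)[OF assms(1)] \<open>b \<in> bosons A\<close> by (rule subsetD)
  moreover have "v = b \<and> w = f \<or> v = f \<and> w = b" using e by (simp add: doubleton_eq_iff)
  ultimately show "v \<in> verts A" "w \<in> verts A" "v \<noteq> w" "v \<in> bosons A \<longleftrightarrow> w \<notin> bosons A"
    by (auto simp: fermions_def)
  show "mu A {v, w} \<in> {- 1, 1}" "color A {v, w} \<in> {1..n}"
    using adinkraD(5,6)[OF assms] by simp_all
qed

lemma adinkra_edge_color_unique: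
  assumes "adinkra n A" "{v, w} \<in> edges A" "{v, w'} \<in> edges A"
    and "color A {v, w} = color A {v, w'}"
  shows "w = w'"
proof -
  have "\<exists>!e. e \<in> edges A \<and> v \<in> e \<and> color A e = color A {v, w}"
    by (rule adinkraD(7)[OF assms(1) adinkra_edgeD(1,6)[OF assms(1,2)]])
  then have "{v, w} = {v, w'}" using assms(2-4) by (metis insertI1)
  then show ?thesis by (auto simp: doubleton_eq_iff)
qed

lemma color_nbr_eqI:
  assumes "adinkra n A" "{v, w} \<in> edges A" "color A {v, w} = i"
  shows "color_nbr A i v = w"
  unfolding color_nbr_def using assms adinkra_edge_color_unique[OF assms(1)] by blast

lemma color_nbr_edge:
  assumes "adinkra n A" "v \<in> verts A" "i \<in> {1..n}"
  shows "{v, color_nbr A i v} \<in> edges A" "color A {v, color_nbr A i v} = i"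
proof -
  obtain e where e: "e \<in> edges A" "v \<in> e" "color A e = i"
    using adinkraD(7)[OF assms] by (elim ex1E) blast
  moreover obtain w where "e = {v, w}"
    using adinkraD(4)[OF assms(1) e(1)] e(2) by (auto simp: insert_commute)
  ultimately have "{v, w} \<in> edges A" "color A {v, w} = i" by auto
  then show "{v, color_nbr A i v} \<in> edges A" "color A {v, color_nbr A i v} = i"
    using color_nbr_eqI[OF assms(1)] by metis+
qed

lemma color_nbr_involution:
  assumes "adinkra n A" "v \<in> verts A" "i \<in> {1..n}"
  shows "color_nbr A i (color_nbr A i v) = v"
  using color_nbr_edge[OF assms] color_nbr_eqI[OF assms(1)] by (metis insert_commute)

lemma color_nbr_in_verts:
  assumes "adinkra n A" "v \<in> verts A" "i \<in> {1..n}"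
  shows "color_nbr A i v \<in> verts A"
  using adinkra_edgeD(2)[OF assms(1) color_nbr_edge(1)[OF assms]] .

text \<open>The row of \<open>v\<close> has one nonzero entry for each color.\<close>

lemma sum_signed_adj:
  assumes A: "adinkra n A" and v: "v \<in> verts A"
  shows "(\<Sum>w\<in>verts A. signed_adj A v w * g w)
       = (\<Sum>i\<in>{1..n}. mu A {v, color_nbr A i v} * g (color_nbr A i v))"
proof -
  have "bij_betw (\<lambda>i. color_nbr A i v) {1..n} {w. {v, w} \<in> edges A}"
  proof (rule bij_betwI[where g = "\<lambda>w. color A {v, w}"])
    show "(\<lambda>w. color A {v, w}) \<in> {w. {v, w} \<in> edges A} \<rightarrow> {1..n}"
      using adinkra_edgeD(6)[OF A] by blast
  qed (use color_nbr_edge[OF A v] color_nbr_eqI[OF A] in auto)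
  moreover have "{w. {v, w} \<in> edges A} \<subseteq> verts A"
    using adinkra_edgeD(2)[OF A] by blast
  moreover have "finite (verts A)" by (rule adinkraD(2)[OF A])
  ultimately have "(\<Sum>i\<in>{1..n}. mu A {v, color_nbr A i v} * g (color_nbr A i v))
     = (\<Sum>w\<in>{w. {v, w} \<in> edges A}. mu A {v, w} * g w)"
    by (simp add: sum.reindex_bij_betw[where g = "\<lambda>w. mu A {v, w} * g w"])
  also have "\<dots> = (\<Sum>w\<in>{w. {v, w} \<in> edges A}. signed_adj A v w * g w)"
    by (intro sum.cong) (auto simp: signed_adj_def)
  also have "\<dots> = (\<Sum>w\<in>verts A. signed_adj A v w * g w)"
    by (intro sum.mono_neutral_left) (use \<open>finite _\<close> \<open>_ \<subseteq> verts A\<close> in \<open>auto simp: signed_adj_def\<close>)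
  finally show ?thesis by simp
qed

lemma prod_sign_eq_minus_one_power:
  assumes "finite F" "\<And>e. e \<in> F \<Longrightarrow> m e \<in> {- 1, 1 :: int}"
  shows "(\<Prod>e\<in>F. m e) = (- 1) ^ card {e \<in> F. m e = - 1}"
proof -
  have "(\<Prod>e\<in>F. m e) = (\<Prod>e\<in>F. if m e = - 1 then - 1 else 1)"
    using assms(2) by (intro prod.cong) auto
  also have "\<dots> = (\<Prod>e\<in>{e \<in> F. m e = - 1}. - 1)"
    using assms(1) by (rule prod.inter_filter[symmetric])
  finally show ?thesis by simp
qed

lemma four_cycle_fourth_vertex:
  assumes "four_cycle F" "{v, w} \<in> F" "{w, u} \<in> F" "v \<noteq> u"
  obtains x where "distinct [v, w, u, x]" "F = {{v, w}, {w, u}, {u, x}, {x, v}}"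
proof -
  \<comment> \<open>A traversal of the cycle may be rotated and reversed, hence started with \<open>v\<close> and \<open>w\<close>.\<close>
  define cyc where "cyc a b c d \<longleftrightarrow> distinct [a, b, c, d] \<and> F = {{a, b}, {b, c}, {c, d}, {d, a}}"
    for a b c d
  have rot: "cyc b c d a" if "cyc a b c d" for a b c d
    using that unfolding cyc_def by auto
  have refl: "cyc b a d c" if "cyc a b c d" for a b c d
    using that unfolding cyc_def by (auto simp: insert_commute)
  obtain a b c d where "cyc a b c d"
    using assms(1) by (auto simp: four_cycle_def cyc_def)
  moreover from this have "{v, w} \<in> {{a, b}, {b, c}, {c, d}, {d, a}}"
    using assms(2) by (simp add: cyc_def)
  ultimately obtain y x where y: "cyc v w y x"
    unfolding insert_iff empty_iff doubleton_eq_iff by (metis rot refl)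
  then have "{w, u} \<in> {{v, w}, {w, y}, {y, x}, {x, v}}" "distinct [v, w, y, x]"
    using assms(3) by (simp_all add: cyc_def)
  then have "y = u"
    using assms(4) by (auto simp: doubleton_eq_iff)
  then show ?thesis using y that unfolding cyc_def by blast
qed

text \<open>Following the colors \<open>i\<close> and \<open>j\<close> from \<open>v\<close> in either order leads to the opposite corner \<open>u\<close> of one
  bicolor cycle, by its two halves. The product of all four signs is \<open>- 1\<close>, so the two halves carry
  opposite signs.\<close>

lemma color_nbr_anticommute:
  assumes A: "adinkra n A" and v: "v \<in> verts A"
    and ij: "i \<in> {1..n}" "j \<in> {1..n}" "i \<noteq> j"
  shows "color_nbr A j (color_nbr A i v) = color_nbr A i (color_nbr A j v)"
    and "mu A {v, color_nbr A i v} * mu A {color_nbr A i v, color_nbr A j (color_nbr A i v)}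
     = - (mu A {v, color_nbr A j v} * mu A {color_nbr A j v, color_nbr A i (color_nbr A j v)})"
proof -
  define w where "w = color_nbr A i v"
  define u where "u = color_nbr A j w"
  have vw: "{v, w} \<in> edges A" "color A {v, w} = i"
    using color_nbr_edge[OF A v ij(1)] by (auto simp: w_def)
  have "w \<in> verts A" using color_nbr_in_verts[OF A v ij(1)] by (simp add: w_def)
  then have wu: "{w, u} \<in> edges A" "color A {w, u} = j"
    using color_nbr_edge[OF A _ ij(2)] by (auto simp: u_def)
  have "v \<noteq> u" using vw wu ij(3) by (auto simp: insert_commute)
  obtain CC where "\<forall>F\<in>CC. four_cycle F" "\<forall>F\<in>CC. \<forall>G\<in>CC. F \<noteq> G \<longrightarrow> \<Union>F \<inter> \<Union>G = {}"
      and Union_CC: "\<Union>CC = color_edges A i \<union> color_edges A j"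
    using adinkraD(8)[OF A ij] unfolding disjoint_union_of_four_cycles_def by (elim exE conjE)
  then have CC: "\<And>F. F \<in> CC \<Longrightarrow> four_cycle F"
      "\<And>F G. F \<in> CC \<Longrightarrow> G \<in> CC \<Longrightarrow> F \<noteq> G \<Longrightarrow> \<Union>F \<inter> \<Union>G = {}"
    by simp_all
  have "{v, w} \<in> \<Union>CC" "{w, u} \<in> \<Union>CC"
    using vw wu by (simp_all add: Union_CC color_edges_def)
  then obtain F G where F: "F \<in> CC" "{v, w} \<in> F" and G: "G \<in> CC" "{w, u} \<in> G"
    by (elim UnionE)
  have "w \<in> \<Union>F \<inter> \<Union>G" using F G by auto
  then have "F = G" using CC(2)[OF F(1) G(1)] by auto
  then have "{w, u} \<in> F" using G by simp
  then obtain x where dist: "distinct [v, w, u, x]" and Feq: "F = {{v, w}, {w, u}, {u, x}, {x, v}}"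
    using four_cycle_fourth_vertex[OF CC(1)[OF F(1)] F(2)] \<open>v \<noteq> u\<close> by blast
  have bc: "bicolor_cycle A i j F"
    unfolding bicolor_cycle_def Union_CC[symmetric] using CC(1)[OF F(1)] F(1) by (simp add: Union_upper)
  then have FE: "F \<subseteq> color_edges A i \<union> color_edges A j"
    by (simp add: bicolor_cycle_def)
  have ux: "{u, x} = {x, u}" and xv: "{x, v} = {v, x}" and uw: "{u, w} = {w, u}" by auto
  have "{u, x} \<in> F" "{x, v} \<in> F" by (simp_all add: Feq)
  then have "{u, x} \<in> color_edges A i \<union> color_edges A j" "{x, v} \<in> color_edges A i \<union> color_edges A j"
    using FE by (simp_all only: subsetD)
  then have e: "{u, x} \<in> edges A" "color A {u, x} = i \<or> color A {u, x} = j"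
      "{v, x} \<in> edges A" "color A {v, x} = i \<or> color A {v, x} = j"
    unfolding xv by (auto simp: color_edges_def)
  \<comment> \<open>The colors alternate along the cycle, as no vertex has two edges of the same color.\<close>
  have "color A {u, x} \<noteq> j"
    using adinkra_edge_color_unique[OF A e(1), of w] wu dist unfolding uw by auto
  then have cux: "color A {u, x} = i" using e by simp
  have "color A {v, x} \<noteq> i"
    using adinkra_edge_color_unique[OF A e(3) vw(1)] vw(2) dist by auto
  then have cvx: "color A {v, x} = j" using e by simp
  have x: "color_nbr A j v = x"
    by (rule color_nbr_eqI[OF A e(3) cvx])
  have u: "color_nbr A i x = u"
    by (rule color_nbr_eqI[OF A e(1)[unfolded ux] cux[unfolded ux]])
  show "color_nbr A j (color_nbr A i v) = color_nbr A i (color_nbr A j v)"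
    using x u by (simp add: w_def u_def)
  have mu: "mu A e \<in> {- 1, 1}" if "e \<in> F" for e
    by (rule adinkraD(5)[OF A]) (use FE that in \<open>auto simp: color_edges_def\<close>)
  have "odd (card {e \<in> F. dashed A e})"
    by (rule adinkraD(9)[OF A ij bc])
  then have "(\<Prod>e\<in>F. mu A e) = - 1"
    using prod_sign_eq_minus_one_power[of F "mu A"] mu by (simp add: dashed_def Feq)
  moreover have "{v, w} \<notin> {{w, u}, {u, x}, {x, v}}" "{w, u} \<notin> {{u, x}, {x, v}}" "{u, x} \<noteq> {x, v}"
    using dist by (auto simp: doubleton_eq_iff)
  ultimately have "mu A {v, w} * (mu A {w, u} * (mu A {u, x} * mu A {x, v})) = - 1"
    unfolding Feq by simp
  moreover have "mu A {v, w} \<in> {- 1, 1}" "mu A {w, u} \<in> {- 1, 1}"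
      "mu A {u, x} \<in> {- 1, 1}" "mu A {x, v} \<in> {- 1, 1}"
    by (rule mu, simp add: Feq)+
  ultimately have "mu A {v, w} * mu A {w, u} = - (mu A {v, x} * mu A {x, u})"
    unfolding ux xv by auto
  then show "mu A {v, color_nbr A i v} * mu A {color_nbr A i v, color_nbr A j (color_nbr A i v)}
     = - (mu A {v, color_nbr A j v} * mu A {color_nbr A j v, color_nbr A i (color_nbr A j v)})"
    by (simp add: x u flip: w_def u_def)
qed

text \<open>In the square of a sum of anticommuting involutions the mixed terms cancel in pairs, and each of
  the \<open>n\<close> colors contributes the identity. Here \<open>T i j\<close> is the \<open>(v, u)\<close> entry of the product of
  the matrices of the colors \<open>i\<close> and \<open>j\<close>.\<close>

lemma signed_adj_square:
  assumes A: "adinkra n A" and v: "v \<in> verts A" and u: "u \<in> verts A"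
  shows "(\<Sum>w\<in>verts A. signed_adj A v w * signed_adj A w u) = (if v = u then int n else 0)"
proof -
  define T where "T i j = mu A {v, color_nbr A i v} *
      (mu A {color_nbr A i v, color_nbr A j (color_nbr A i v)} *
        (if color_nbr A j (color_nbr A i v) = u then 1 else 0))" for i j
  have expand: "signed_adj A w u = (\<Sum>j\<in>{1..n}. mu A {w, color_nbr A j w} *
      (if color_nbr A j w = u then 1 else 0))" if "w \<in> verts A" for w
  proof -
    have "signed_adj A w u = (\<Sum>x\<in>verts A. signed_adj A w x * (if x = u then 1 else 0))"
      using adinkraD(2)[OF A] u by (simp add: if_distrib[of "\<lambda>t. _ * t"] cong: if_cong)
    then show ?thesis using sum_signed_adj[OF A that, of "\<lambda>x. if x = u then 1 else 0"] by metis
  qed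
  have S: "(\<Sum>w\<in>verts A. signed_adj A v w * signed_adj A w u) = (\<Sum>i\<in>{1..n}. \<Sum>j\<in>{1..n}. T i j)"
    unfolding sum_signed_adj[OF A v] T_def sum_distrib_left[symmetric]
    by (rule sum.cong[OF refl]) (subst expand[OF color_nbr_in_verts[OF A v]], auto)
  have diag: "T i i = (if v = u then 1 else 0)" if "i \<in> {1..n}" for i
    using color_nbr_involution[OF A v that] adinkra_edgeD(5)[OF A color_nbr_edge(1)[OF A v that]]
    by (auto simp: T_def insert_commute)
  have anti: "T j i = - T i j" if "i \<in> {1..n}" "j \<in> {1..n}" "i \<noteq> j" for i j
  proof -
    note comm = color_nbr_anticommute(1)[OF A v that]
    show ?thesis
      unfolding T_def mult.assoc[symmetric] comm
        color_nbr_anticommute(2)[OF A v that, unfolded comm] by simp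
  qed
  \<comment> \<open>Adding the sum to its transpose cancels the mixed terms.\<close>
  have "2 * (\<Sum>i\<in>{1..n}. \<Sum>j\<in>{1..n}. T i j)
     = (\<Sum>i\<in>{1..n}. \<Sum>j\<in>{1..n}. T i j) + (\<Sum>i\<in>{1..n}. \<Sum>j\<in>{1..n}. T j i)"
    unfolding mult_2 by (rule arg_cong2[OF refl sum.swap])
  also have "\<dots> = (\<Sum>i\<in>{1..n}. \<Sum>j\<in>{1..n}. if i = j then 2 * (if v = u then 1 else 0) else 0)"
    unfolding sum.distrib[symmetric] by (intro sum.cong refl) (metis anti diag mult_2 add.right_inverse)
  also have "\<dots> = 2 * (if v = u then int n else 0)"
    by simp
  finally show ?thesis using S by simp
qed

lemma signed_adj_eq_0:
  assumes "adinkra n A" "v \<in> bosons A \<longleftrightarrow> w \<in> bosons A"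
  shows "signed_adj A v w = 0"
  using adinkra_edgeD(4)[OF assms(1)] assms(2) by (auto simp: signed_adj_def)

lemma sum_signed_adj_opposite:
  assumes A: "adinkra n A" and v: "v \<in> verts A" and u: "u \<in> verts A"
    and "W = (if v \<in> bosons A then fermions A else bosons A)"
  shows "(\<Sum>w\<in>W. signed_adj A v w * signed_adj A w u) = (if v = u then int n else 0)"
proof -
  have "(\<Sum>w\<in>W. signed_adj A v w * signed_adj A w u)
      = (\<Sum>w\<in>verts A. signed_adj A v w * signed_adj A w u)"
    using adinkraD(2,3)[OF A] assms(4) signed_adj_eq_0[OF A]
    by (intro sum.mono_neutral_left) (auto simp: fermions_def)
  then show ?thesis using signed_adj_square[OF A v u] by simp
qed

text \<open>Both \<open>X * X\<^sup>T\<close> and \<open>X\<^sup>T * X\<close> are \<open>n\<close> times an identity matrix, of sizes the numbers of bosons and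
  of fermions, and they have the same trace.\<close>

lemma card_bosons_eq_card_fermions:
  assumes A: "adinkra n A"
  shows "card (bosons A) = card (fermions A)"
proof -
  have B: "bosons A \<subseteq> verts A" and n: "n \<ge> 1" using adinkraD[OF A] by simp_all
  have F: "\<And>f. f \<in> fermions A \<Longrightarrow> f \<in> verts A \<and> f \<notin> bosons A" by (simp add: fermions_def)
  have "int n * card (bosons A) = (\<Sum>b\<in>bosons A. \<Sum>f\<in>fermions A. signed_adj A b f * signed_adj A f b)"
    using B by (subst sum.cong[OF refl sum_signed_adj_opposite[OF A]]) auto
  also have "\<dots> = (\<Sum>f\<in>fermions A. \<Sum>b\<in>bosons A. signed_adj A f b * signed_adj A b f)"
    by (subst sum.swap) (simp add: mult.commute)
  also have "\<dots> = int n * card (fermions A)"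
    using F by (subst sum.cong[OF refl sum_signed_adj_opposite[OF A]]) auto
  finally show ?thesis using n by simp
qed

definition laplacian_entry :: "nat \<Rightarrow> 'v adinkra_graph \<Rightarrow> 'v \<Rightarrow> 'v \<Rightarrow> int" where
  "laplacian_entry N A v w = (if v = w then int N else 0) - signed_adj A v w"

lemma boson_fermion_mat_eq: "boson_fermion_mat A bs fs = fun_mat (signed_adj A) bs fs"
  by (simp add: boson_fermion_mat_def fun_mat_def signed_adj_def)

lemma signed_laplacian_eq:
  assumes A: "adinkra n A" and bs: "enumerates bs (bosons A)" and fs: "enumerates fs (fermions A)"
  shows "signed_laplacian N A bs fs = fun_mat (laplacian_entry N A) (bs @ fs) (bs @ fs)"
proof -
  have diag: "int N \<cdot>\<^sub>m 1\<^sub>m (length xs) = fun_mat (laplacian_entry N A) xs xs"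
    if "distinct xs" "set xs \<subseteq> bosons A \<or> set xs \<inter> bosons A = {}" for xs
  proof (rule eq_matI)
    fix i j assume "i < dim_row (fun_mat (laplacian_entry N A) xs xs)"
      "j < dim_col (fun_mat (laplacian_entry N A) xs xs)"
    then have ij: "i < length xs" "j < length xs" by simp_all
    then have "xs ! i \<in> set xs" "xs ! j \<in> set xs" by simp_all
    then have "signed_adj A (xs ! i) (xs ! j) = 0"
      using that(2) by (intro signed_adj_eq_0[OF A]) blast
    then show "(int N \<cdot>\<^sub>m 1\<^sub>m (length xs)) $$ (i, j) = fun_mat (laplacian_entry N A) xs xs $$ (i, j)"
      using ij that(1) by (simp add: laplacian_entry_def nth_eq_iff_index_eq)
  qed simp_all
  have disj: "b \<noteq> f" if "b \<in> set bs" "f \<in> set fs" for b f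
    using that bs fs by (auto simp: enumerates_def fermions_def)
  have "- fun_mat (signed_adj A) bs fs = fun_mat (laplacian_entry N A) bs fs"
    by (rule eq_matI) (auto simp: laplacian_entry_def disj)
  moreover have "- transpose_mat (fun_mat (signed_adj A) bs fs) = fun_mat (laplacian_entry N A) fs bs"
    by (rule eq_matI) (auto simp: laplacian_entry_def disj[symmetric] signed_adj_sym)
  moreover have "set bs = bosons A" "set fs \<inter> bosons A = {}" "distinct bs" "distinct fs"
    using bs fs by (auto simp: enumerates_def fermions_def)
  ultimately show ?thesis
    by (simp add: signed_laplacian_def boson_fermion_mat_eq fun_mat_append diag)
qed

section \<open>Prisms\<close>

text \<open>Horizontal edges stay in their level and vertical edges change it, so the levels of its endpoints
  tell which kind an edge of the prism is.\<close>

lemma prism_edges_cases: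
  assumes "is_prism n A' A" "{(v, s), (w, t)} \<in> edges A"
  obtains "s = t" "{v, w} \<in> edges A'" | "s \<noteq> t" "v = w" "v \<in> verts A'"
proof -
  from assms consider e r where "e \<in> edges A'" "{(v, s), (w, t)} = (\<lambda>v. (v, r)) ` e"
    | x where "x \<in> verts A'" "{(v, s), (w, t)} = {(x, 0), (x, 1)}"
    unfolding is_prism_def by auto
  then show ?thesis
  proof cases
    case 1
    have "e = fst ` {(v, s), (w, t)}" "snd ` {(v, s), (w, t)} \<subseteq> {r}"
      unfolding 1(2) by (auto simp: image_image)
    then show ?thesis using 1(1) that(1) by simp
  next
    case 2
    then show ?thesis using that(2) by (auto simp: doubleton_eq_iff)
  qed
qed

lemma prism_signed_adj_same_level:
  assumes P: "is_prism n A' A" and t: "t \<in> {0, 1}"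
  shows "signed_adj A (v, t) (w, t) = signed_adj A' v w"
proof (cases "{v, w} \<in> edges A'")
  case True
  have im: "{(v, t), (w, t)} = (\<lambda>v. (v, t)) ` {v, w}" by simp
  have "{(v, t), (w, t)} \<in> edges A" "mu A {(v, t), (w, t)} = mu A' {v, w}"
    unfolding im using P True t unfolding is_prism_def by blast+
  then show ?thesis using True by (simp add: signed_adj_def)
next
  case False
  then show ?thesis using prism_edges_cases[OF P] by (metis signed_adj_def)
qed

lemma prism_signed_adj_vertical:
  assumes P: "is_prism n A' A" and v: "v \<in> verts A'"
    and st: "s \<in> {0, 1}" "t \<in> {0, 1}" "s \<noteq> t"
  shows "signed_adj A (v, s) (w, t) = (if v = w then if v \<in> bosons A' then - 1 else 1 else 0)"
proof (cases "v = w")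
  case True
  have "{(v, 0), (v, 1)} \<in> edges A" "mu A {(v, 0), (v, 1)} = (if v \<in> bosons A' then - 1 else 1)"
    using P v unfolding is_prism_def by blast+
  moreover have "{(v, s), (w, t)} = {(v, 0), (v, 1)}"
    using st True by auto
  ultimately show ?thesis using True by (simp add: signed_adj_def)
next
  case False
  then show ?thesis using prism_edges_cases[OF P, of v s w t] st by (auto simp: signed_adj_def)
qed

section \<open>The boson-fermion matrix and the Laplacian of a prism\<close>

lemma obtain_enumeration:
  assumes "finite S"
  obtains xs where "distinct xs" "set xs = S" "length xs = card S"
  using finite_distinct_list[OF assms] distinct_card by metis

lemma prism_verts:
  assumes "adinkra n A'" "is_prism n A' A"
  shows "bosons A = bosons A' \<times> {0} \<union> fermions A' \<times> {1}"
    and "fermions A = fermions A' \<times> {0} \<union> bosons A' \<times> {1}"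
    and "card (verts A') = 2 * card (bosons A')"
    and "card (verts A) = 4 * card (bosons A')"
proof -
  have V: "verts A = verts A' \<times> {0, 1}" and B: "bosons A = bosons A' \<times> {0} \<union> fermions A' \<times> {1}"
    using assms(2) by (simp_all add: is_prism_def)
  have fin: "finite (verts A')" and sub: "bosons A' \<subseteq> verts A'"
    using adinkraD(2,3)[OF assms(1)] by simp_all
  show "bosons A = bosons A' \<times> {0} \<union> fermions A' \<times> {1}" by (rule B)
  show "fermions A = fermions A' \<times> {0} \<union> bosons A' \<times> {1}"
    unfolding fermions_def[of A] V B using sub by (auto simp: fermions_def)
  have "card (verts A') = card (bosons A') + card (fermions A')"
    unfolding fermions_def using fin sub card_mono[OF fin sub]
    by (simp add: card_Diff_subset finite_subset)
  then show "card (verts A') = 2 * card (bosons A')"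
    using card_bosons_eq_card_fermions[OF assms(1)] by simp
  then show "card (verts A) = 4 * card (bosons A')"
    unfolding V by (simp add: card_cartesian_product)
qed

text \<open>The rows and columns are paired off by the vertical edges: those at fermions of the base give the
  pivot \<open>?I\<close>, and those at bosons the block \<open>?J\<close>, which is minus an identity matrix.\<close>

theorem prism_boson_fermion_invariant_factors:
  fixes A :: "('v \<times> nat) adinkra_graph"
  assumes A': "adinkra n A'" and P: "is_prism n A' A"
    and bs: "enumerates bs (bosons A)" and fs: "enumerates fs (fermions A)"
    and k: "k = card (bosons A')"
  shows "has_invariant_factors (boson_fermion_mat A bs fs)
    (replicate k 1 @ replicate k (int n + 1))"
proof -
  have V': "bosons A' \<subseteq> verts A'" "fermions A' \<subseteq> verts A'" "finite (bosons A')" "finite (fermions A')"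
    using adinkraD(2,3)[OF A'] by (auto simp: fermions_def intro: finite_subset)
  obtain b0 where b0: "distinct b0" "set b0 = bosons A'" "length b0 = k"
    using obtain_enumeration[OF V'(3)] k by metis
  obtain f0 where f0: "distinct f0" "set f0 = fermions A'" "length f0 = k"
    using obtain_enumeration[OF V'(4)] k card_bosons_eq_card_fermions[OF A'] by metis
  let ?rows = "map (\<lambda>v. (v, 1::nat)) f0 @ map (\<lambda>v. (v, 0)) b0"
  let ?cols = "map (\<lambda>v. (v, 0::nat)) f0 @ map (\<lambda>v. (v, 1)) b0"
  let ?I = "fun_mat (\<lambda>v w. if v = w then 1 else 0) f0 f0"
  let ?J = "fun_mat (\<lambda>v w. if v = w then - 1 else 0) b0 b0"
  let ?X = "fun_mat (signed_adj A') b0 f0"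
  let ?Xt = "fun_mat (signed_adj A') f0 b0"
  have blocks: "fun_mat (signed_adj A) ?rows ?cols = four_block_mat ?I ?Xt ?X ?J"
  proof -
    have "fun_mat (\<lambda>v w. signed_adj A (v, 1) (w, 0)) f0 f0 = ?I"
      by (rule fun_mat_cong, subst prism_signed_adj_vertical[OF P])
         (use V' f0 in \<open>auto simp: fermions_def\<close>)
    moreover have "fun_mat (\<lambda>v w. signed_adj A (v, 0) (w, 1)) b0 b0 = ?J"
      by (rule fun_mat_cong, subst prism_signed_adj_vertical[OF P]) (use V' b0 in auto)
    ultimately show ?thesis
      by (simp add: fun_mat_append fun_mat_map prism_signed_adj_same_level[OF P])
  qed
  have "?X * ?I * ?Xt + (int n + 1) \<cdot>\<^sub>m ?J = ?J"
  proof -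
    have "?X * ?I * ?Xt = fun_mat (\<lambda>b c. if b = c then int n else 0) b0 b0"
    proof (unfold fun_mat_mult[OF f0(1)], rule fun_mat_cong)
      fix b c assume "b \<in> set b0" "c \<in> set b0"
      then have "b \<in> bosons A'" "b \<in> verts A'" "c \<in> verts A'"
        using b0(2) V'(1) by auto
      then have "(\<Sum>f\<in>set f0. signed_adj A' b f * signed_adj A' f c) = (if b = c then int n else 0)"
        by (intro sum_signed_adj_opposite[OF A']) (simp_all add: f0(2))
      then show "(\<Sum>f\<in>set f0. (\<Sum>g\<in>set f0. signed_adj A' b g * (if g = f then 1 else 0)) * signed_adj A' f c)
          = (if b = c then int n else 0)"
        by (simp add: if_distrib[of "\<lambda>t. _ * t"] cong: if_cong)
    qed
    then show ?thesis
      by (auto simp: fun_mat_add fun_mat_smult intro!: fun_mat_cong)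
  qed
  then have schur: "?J = ?X * ?I * ?Xt + (int n + 1) \<cdot>\<^sub>m ?J"
    by (rule sym)
  have car: "?I \<in> carrier_mat k k" "?J \<in> carrier_mat k k" "?X \<in> carrier_mat k k" "?Xt \<in> carrier_mat k k"
    by (rule carrier_matI; simp only: dim_fun_mat b0(3) f0(3))+
  have II: "?I * ?I = 1\<^sub>m k" and JJ: "?J * ?J = 1\<^sub>m k"
    using diag_fun_mat_square[OF f0(1), of "\<lambda>_. 1"] diag_fun_mat_square[OF b0(1), of "\<lambda>_. - 1"] b0(3) f0(3)
    by simp_all
  have "has_invariant_factors (four_block_mat ?I ?Xt ?X ?J)
      (replicate k 1 @ replicate k (int n + 1))"
    by (rule has_invariant_factors_Schur[OF car(1,1,4,3,2,2) II II JJ JJ schur]) simp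
  then have "has_invariant_factors (fun_mat (signed_adj A) ?rows ?cols)
      (replicate k 1 @ replicate k (int n + 1))"
    by (simp only: blocks)
  moreover have rows: "distinct ?rows" "set bs = set ?rows"
    using b0 f0 bs by (auto simp: distinct_map inj_on_def enumerates_def prism_verts(1)[OF A' P])
  moreover have cols: "distinct ?cols" "set fs = set ?cols"
    using b0 f0 fs by (auto simp: distinct_map inj_on_def enumerates_def prism_verts(2)[OF A' P])
  moreover have "distinct bs" "distinct fs" using bs fs by (simp_all add: enumerates_def)
  moreover have "length bs = length fs"
  proof -
    have "length bs = length ?rows" using rows \<open>distinct bs\<close> by (metis distinct_card)
    moreover have "length fs = length ?cols" using cols \<open>distinct fs\<close> by (metis distinct_card)
    ultimately show ?thesis by simp
  qed
  ultimately have "has_invariant_factors (fun_mat (signed_adj A) bs fs)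
      (replicate k 1 @ replicate k (int n + 1))"
    by - (rule has_invariant_factors_reindex[where xs' = ?rows and ys' = ?cols]; assumption)
  then show ?thesis
    by (simp add: boson_fermion_mat_eq)
qed

text \<open>The pivot consists of the vertical edges from level 1 to level 0. Its Schur complement is found by
  moving \<open>\<epsilon>\<close> to the left, which turns the first factor \<open>N - S\<close> into \<open>N + S\<close> (the fact \<open>TE\<close>), and
  multiplying out.\<close>

theorem prism_laplacian_invariant_factors:
  fixes A :: "('v \<times> nat) adinkra_graph"
  assumes A': "adinkra n A'" and P: "is_prism n A' A" and A: "adinkra (n + 1) A"
    and bs: "enumerates bs (bosons A)" and fs: "enumerates fs (fermions A)"
    and k: "k = card (verts A')"
  shows "has_invariant_factors (signed_laplacian (n + 1) A bs fs)
    (replicate k 1 @ replicate k ((int n + 1) * int n))"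
proof -
  obtain vs where vs: "distinct vs" "set vs = verts A'" "length vs = k"
    using obtain_enumeration[OF adinkraD(2)[OF A']] k by metis
  define \<epsilon> where "\<epsilon> v = (if v \<in> bosons A' then 1 else - 1 :: int)" for v
  have \<epsilon>: "\<epsilon> v * \<epsilon> v = 1" for v by (simp add: \<epsilon>_def)
  have \<epsilon>_anti: "signed_adj A' v w * \<epsilon> w = - (\<epsilon> v * signed_adj A' v w)" for v w
    using signed_adj_eq_0[OF A', of v w] by (auto simp: \<epsilon>_def)
  define T where "T = laplacian_entry (n + 1) A'"
  let ?rows = "map (\<lambda>v. (v, 1::nat)) vs @ map (\<lambda>v. (v, 0)) vs"
  let ?cols = "map (\<lambda>v. (v, 0::nat)) vs @ map (\<lambda>v. (v, 1)) vs"
  let ?E = "fun_mat (\<lambda>v w. if v = w then \<epsilon> v else 0) vs vs"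
  let ?J = "fun_mat (\<lambda>v w. if v = w then - \<epsilon> v else 0) vs vs"
  let ?T = "fun_mat T vs vs"
  have blocks: "fun_mat (laplacian_entry (n + 1) A) ?rows ?cols = four_block_mat ?E ?T ?T ?E"
  proof -
    have "fun_mat (\<lambda>v w. laplacian_entry (n + 1) A (v, s) (w, t)) vs vs = ?E"
      if "s \<in> {0, 1}" "t \<in> {0, 1}" "s \<noteq> t" for s t
      by (rule fun_mat_cong, unfold laplacian_entry_def, subst prism_signed_adj_vertical[OF P _ that])
         (use vs that in \<open>auto simp: \<epsilon>_def\<close>)
    moreover have "fun_mat (\<lambda>v w. laplacian_entry (n + 1) A (v, t) (w, t)) vs vs = ?T"
      if "t \<in> {0, 1}" for t
      by (rule fun_mat_cong) (simp add: laplacian_entry_def T_def prism_signed_adj_same_level[OF P that])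
    ultimately show ?thesis
      by (simp add: fun_mat_append fun_mat_map)
  qed
  have "?T * ?E * ?T + ((int n + 1) * int n) \<cdot>\<^sub>m ?J = ?E"
  proof -
    let ?N = "int n + 1"
    have "?T * ?E * ?T = fun_mat (\<lambda>v w. if v = w then \<epsilon> v * (?N * ?N - int n) else 0) vs vs"
    proof (unfold fun_mat_mult[OF vs(1)], rule fun_mat_cong)
      fix v w assume vw: "v \<in> set vs" "w \<in> set vs"
      have TE: "(\<Sum>y\<in>set vs. T v y * (if y = x then \<epsilon> y else 0))
          = \<epsilon> v * ((if v = x then ?N else 0) + signed_adj A' v x)" if "x \<in> set vs" for x
      proof -
        have "(\<Sum>y\<in>set vs. T v y * (if y = x then \<epsilon> y else 0)) = T v x * \<epsilon> x"
          using that by (simp add: if_distrib[of "\<lambda>t. _ * t"] cong: if_cong)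
        also have "\<dots> = (if v = x then ?N else 0) * \<epsilon> x - signed_adj A' v x * \<epsilon> x"
          by (simp add: T_def laplacian_entry_def algebra_simps)
        also have "\<dots> = \<epsilon> v * ((if v = x then ?N else 0) + signed_adj A' v x)"
          unfolding \<epsilon>_anti by (simp add: algebra_simps)
        finally show ?thesis .
      qed
      have "(\<Sum>x\<in>set vs. (\<Sum>y\<in>set vs. T v y * (if y = x then \<epsilon> y else 0)) * T x w)
          = (\<Sum>x\<in>set vs. \<epsilon> v * (((if v = x then ?N else 0) + signed_adj A' v x) * T x w))"
        by (rule sum.cong[OF refl]) (simp only: TE mult.assoc)
      also have "\<dots> = \<epsilon> v * (\<Sum>x\<in>set vs. ((if v = x then ?N else 0) + signed_adj A' v x) * T x w)"
        by (simp only: sum_distrib_left)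
      also have "(\<Sum>x\<in>set vs. ((if v = x then ?N else 0) + signed_adj A' v x) * T x w)
          = (\<Sum>x\<in>set vs. (if v = x then ?N * T x w else 0)
              + ((if x = w then ?N * signed_adj A' v x else 0) - signed_adj A' v x * signed_adj A' x w))"
        by (rule sum.cong[OF refl]) (simp add: T_def laplacian_entry_def algebra_simps)
      also have "\<dots> = ?N * T v w
          + (?N * signed_adj A' v w - (\<Sum>x\<in>set vs. signed_adj A' v x * signed_adj A' x w))"
        using vw by (simp add: sum.distrib sum_subtractf)
      also have "\<dots> = (if v = w then ?N * ?N - int n else 0)"
        using vw signed_adj_square[OF A', of v w]
        by (simp add: vs(2) T_def laplacian_entry_def algebra_simps)
      finally show "(\<Sum>x\<in>set vs. (\<Sum>y\<in>set vs. T v y * (if y = x then \<epsilon> y else 0)) * T x w)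
          = (if v = w then \<epsilon> v * (?N * ?N - int n) else 0)"
        by simp
    qed
    then show ?thesis
      by (auto simp: fun_mat_add fun_mat_smult algebra_simps intro!: fun_mat_cong)
  qed
  then have schur: "?E = ?T * ?E * ?T + ((int n + 1) * int n) \<cdot>\<^sub>m ?J"
    by (rule sym)
  have car: "?E \<in> carrier_mat k k" "?J \<in> carrier_mat k k" "?T \<in> carrier_mat k k"
    by (rule carrier_matI; simp only: dim_fun_mat vs(3))+
  have EE: "?E * ?E = 1\<^sub>m k" and JJ: "?J * ?J = 1\<^sub>m k"
    using diag_fun_mat_square[OF vs(1), of \<epsilon>] diag_fun_mat_square[OF vs(1), of "\<lambda>v. - \<epsilon> v"] vs(3)
    by (simp_all add: \<epsilon>)
  have "has_invariant_factors (four_block_mat ?E ?T ?T ?E)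
      (replicate k 1 @ replicate k ((int n + 1) * int n))"
    by (rule has_invariant_factors_Schur[OF car(1,1,3,3,2,2) EE EE JJ JJ schur]) simp
  then have "has_invariant_factors (fun_mat (laplacian_entry (n + 1) A) ?rows ?cols)
      (replicate k 1 @ replicate k ((int n + 1) * int n))"
    by (simp only: blocks)
  moreover have "distinct ?rows" "distinct ?cols"
    using vs by (auto simp: distinct_map inj_on_def)
  moreover have "set (bs @ fs) = verts A"
    using bs fs adinkraD(3)[OF A] by (auto simp: enumerates_def fermions_def)
  then have "set (bs @ fs) = set ?rows" "set (bs @ fs) = set ?cols"
    using P vs by (auto simp: is_prism_def)
  moreover have "distinct (bs @ fs)"
    using bs fs by (auto simp: enumerates_def fermions_def)
  ultimately have "has_invariant_factors (fun_mat (laplacian_entry (n + 1) A) (bs @ fs) (bs @ fs))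
      (replicate k 1 @ replicate k ((int n + 1) * int n))"
    by - (rule has_invariant_factors_reindex[where xs' = ?rows and ys' = ?cols]; (assumption | rule refl))
  then show ?thesis
    by (simp only: signed_laplacian_eq[OF A bs fs])
qed

theorem theorem18:
  fixes N :: nat
    and A' :: "'v adinkra_graph"
    and A :: "('v \<times> nat) adinkra_graph"
    and bs fs :: "('v \<times> nat) list"
  assumes "adinkra N A"
    and "adinkra (N - 1) A'"
    and "is_prism (N - 1) A' A"
    and "enumerates bs (bosons A)"
    and "enumerates fs (fermions A)"
  shows "has_invariant_factors (boson_fermion_mat A bs fs)
           (replicate (card (verts A) div 4) 1 @ replicate (card (verts A) div 4) (int N))
         \<and> has_invariant_factors (signed_laplacian N A bs fs)
           (replicate (card (verts A) div 2) 1 @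
            replicate (card (verts A) div 2) (int N * (int N - 1)))"
proof -
  have N: "N - 1 + 1 = N" "int (N - 1) = int N - 1"
    using adinkraD(1)[OF assms(1)] by auto
  have "card (verts A) div 4 = card (bosons A')" "card (verts A) div 2 = card (verts A')"
    using prism_verts(3,4)[OF assms(2,3)] by simp_all
  moreover have "int (N - 1) + 1 = int N"
    by (simp only: N(2) diff_add_cancel)
  ultimately show ?thesis
    using prism_boson_fermion_invariant_factors[OF assms(2-5) refl]
      prism_laplacian_invariant_factors[OF assms(2,3), unfolded N, OF assms(1,4,5) refl]
    by (simp only: diff_add_cancel)
qed

end
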